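(* Let $G$ be a connected bipartite graph with color classes $E$ and $V$, with any ribbon structure, base node and base edge. Then the simplices $Q_T$, where $T$ ranges over the $V$-cut Jaeger trees of $G$, form a dissection of the root polytope $Q_G$.
   Context: For a bipartite graph $G$ with color classes $E$ (emerald) and $V$ (violet), in $\mathbb R^E\oplus\mathbb R^V$ with standard basis vectors $\mathbf x$ ($x\in E\cup V$), the root polytope is $Q_G=\mathrm{conv}\{\mathbf e+\mathbf v: ev \text{ an edge of } G\}$; for a spanning tree $T$, $Q_T$ is the corresponding simplex (a maximal-dimensional simplex in $Q_G$). A dissection of $Q_G$ is a collection of maximal-dimensional simplices whose union is $Q_G$ and whose interiors are pairwise disjoint. A ribbon structure assigns to each node $x$ a cyclic permutation of its incident edges; $xy^+$ is the edge following $xy$ at $x$. Base node $b_0$, incident base edge $b_0b_1$. Tour of a spanning tree $T$: pairs (current node, current edge) starting with $(b_0,b_0b_1)$; from $(x,xy)$ go to $(x,xy^+)$ if $xy\notin T$, to $(y,yx^+)$ if $xy\in T$; stop right before $(b_0,b_0b_1)$ recurs. Each edge $xy$ appears exactly twice, as $(x,xy)$ and $(y,xy)$; a non-edge $xy$ of $T$ is cut at $x$ if $(x,xy)$ comes first. $T$ is a $V$-cut Jaeger tree if every edge of $G$ not in $T$ is cut at its endpoint in $V$. *)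

theory Defs
  imports "HOL-Analysis.Analysis" "HOL-Combinatorics.Orbits"
begin

text \<open>
  A finite simple graph is given by its set of edges, each edge being a two-element set of nodes.
  The AFP entry \<open>Graph_Theory\<close> is not used: its forests exclude directed cycles, so the
  two arcs that represent an undirected edge already form a cycle there.
\<close>

definition bipartite_graph :: "'a set \<Rightarrow> 'a set \<Rightarrow> 'a set set \<Rightarrow> bool" where
  "bipartite_graph E V G \<longleftrightarrow>
     E \<inter> V = {} \<and> (\<forall>a\<in>G. \<exists>e\<in>E. \<exists>v\<in>V. a = {e, v})"

definition graph_connected :: "'a set \<Rightarrow> 'a set set \<Rightarrow> bool" where
  "graph_connected X G \<longleftrightarrow>
     X \<noteq> {} \<and> (\<forall>x\<in>X. \<forall>y\<in>X. (x, y) \<in> {(u, w). {u, w} \<in> G}\<^sup>*)"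

definition graph_cycle :: "'a set set \<Rightarrow> 'a list \<Rightarrow> bool" where
  "graph_cycle G xs \<longleftrightarrow> 3 \<le> length xs \<and> distinct xs \<and>
     (\<forall>i<length xs. {xs ! i, xs ! (Suc i mod length xs)} \<in> G)"

definition spanning_tree :: "'a set \<Rightarrow> 'a set set \<Rightarrow> 'a set set \<Rightarrow> bool" where
  "spanning_tree X G T \<longleftrightarrow>
     T \<subseteq> G \<and> graph_connected X T \<and> \<not> (\<exists>xs. graph_cycle T xs)"

text \<open>
  \<open>\<rho> x a\<close> is the edge that follows \<open>a\<close> at \<open>x\<close>; only its values on edges
  \<open>a\<close> incident to \<open>x\<close> matter.
\<close>

definition ribbon_structure ::
    "'a set \<Rightarrow> 'a set set \<Rightarrow> ('a \<Rightarrow> 'a set \<Rightarrow> 'a set) \<Rightarrow> bool" where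
  "ribbon_structure X G \<rho> \<longleftrightarrow> (\<forall>x\<in>X. cyclic_on (\<rho> x) {a \<in> G. x \<in> a})"

definition other_end :: "'a \<Rightarrow> 'a set \<Rightarrow> 'a" where
  "other_end x a = (THE y. a = {x, y})"

definition tour_step ::
    "('a \<Rightarrow> 'a set \<Rightarrow> 'a set) \<Rightarrow> 'a set set \<Rightarrow> 'a \<times> 'a set \<Rightarrow> 'a \<times> 'a set" where
  "tour_step \<rho> T = (\<lambda>(x, a).
     if a \<in> T then (let y = other_end x a in (y, \<rho> y a)) else (x, \<rho> x a))"

definition tour_length ::
    "('a \<Rightarrow> 'a set \<Rightarrow> 'a set) \<Rightarrow> 'a set set \<Rightarrow> 'a \<times> 'a set \<Rightarrow> nat" where
  "tour_length \<rho> T s = (LEAST n. 0 < n \<and> (tour_step \<rho> T ^^ n) s = s)"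

text \<open>The starting pair \<open>s\<close> consists of the base node and the base edge.\<close>

definition tour ::
    "('a \<Rightarrow> 'a set \<Rightarrow> 'a set) \<Rightarrow> 'a set set \<Rightarrow> 'a \<times> 'a set \<Rightarrow> ('a \<times> 'a set) list" where
  "tour \<rho> T s = map (\<lambda>n. (tour_step \<rho> T ^^ n) s) [0..<tour_length \<rho> T s]"

definition cut_at ::
    "('a \<Rightarrow> 'a set \<Rightarrow> 'a set) \<Rightarrow> 'a set set \<Rightarrow> 'a \<times> 'a set \<Rightarrow> 'a set \<Rightarrow> 'a \<Rightarrow> bool" where
  "cut_at \<rho> T s a x \<longleftrightarrow>
     (\<exists>i j. i < j \<and> j < length (tour \<rho> T s) \<and>
        tour \<rho> T s ! i = (x, a) \<and> tour \<rho> T s ! j = (other_end x a, a))"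

definition V_cut_Jaeger_tree ::
    "'a set \<Rightarrow> 'a set \<Rightarrow> 'a set set \<Rightarrow> ('a \<Rightarrow> 'a set \<Rightarrow> 'a set) \<Rightarrow> 'a \<times> 'a set \<Rightarrow> 'a set set \<Rightarrow> bool" where
  "V_cut_Jaeger_tree E V G \<rho> s T \<longleftrightarrow>
     spanning_tree (E \<union> V) G T \<and> (\<forall>a\<in>G - T. \<exists>v\<in>a \<inter> V. cut_at \<rho> T s a v)"

text \<open>
  The nodes form the finite index type, so that \<open>real ^ 'n\<close> is the direct sum of
  \<open>\<real>\<^sup>E\<close> and \<open>\<real>\<^sup>V\<close> when \<open>E\<close> and \<open>V\<close> partition \<open>'n\<close>.
\<close>

definition root_polytope :: "'n set \<Rightarrow> 'n set \<Rightarrow> 'n set set \<Rightarrow> (real ^ 'n::finite) set" where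
  "root_polytope E V G =
     convex hull {axis e 1 + axis v 1 | e v. e \<in> E \<and> v \<in> V \<and> {e, v} \<in> G}"

text \<open>
  Root polytopes are not full-dimensional in the ambient space. Interiors are therefore relative
  ones; for the maximal-dimensional simplices in \<open>P\<close> they are the interiors with respect to
  the affine hull of \<open>P\<close>.
\<close>

definition dissection ::
    "'i set \<Rightarrow> ('i \<Rightarrow> 'b::euclidean_space set) \<Rightarrow> 'b set \<Rightarrow> bool" where
  "dissection I S P \<longleftrightarrow>
     (\<forall>i\<in>I. aff_dim P simplex S i) \<and>
     (\<Union>i\<in>I. S i) = P \<and>
     disjoint_family_on (\<lambda>i. rel_interior (S i)) I"

end

theory Submission
  imports Defs "HOL-Library.Transitive_Closure_Table"
begin

text \<open>
  Removing an edge \<open>xy\<close> from a spanning tree \<open>T\<close> splits the nodes into two sides. If the tour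
  of \<open>T\<close> meets \<open>(x, xy)\<close> first, then between \<open>(x, xy)\<close> and \<open>(y, xy)\<close> it meets exactly the pairs
  on the side \<open>B\<close> of \<open>y\<close>. The functional ``emerald coordinates minus violet coordinates on \<open>B\<close>''
  vanishes on all edges of \<open>T\<close> except \<open>xy\<close>.

  Disjointness: let \<open>T\<close> and \<open>T'\<close> be \<open>V\<close>-cut Jaeger trees whose tours first differ at an edge of
  \<open>T\<close> that is not in \<open>T'\<close>. For this edge, the functional is positive on the relative
  interior of \<open>Q\<^sub>T\<close>, while no edge of \<open>T'\<close> runs from the violet nodes outside \<open>B\<close> to the emerald
  nodes in \<open>B\<close>, so that it is nonpositive on \<open>Q\<^sub>T\<^sub>'\<close>.

  Covering: among the spanning trees \<open>T\<close> with \<open>p \<in> Q\<^sub>T\<close>, take the one whose tour lexicographically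
  prefers edges in \<open>T\<close> at emerald nodes and edges outside \<open>T\<close> at violet nodes. If an edge
  outside \<open>T\<close> were cut at its emerald end, a simplex pivot that brings this edge into the tree
  while keeping \<open>p\<close> in the simplex would give a better tree.
\<close>

section \<open>The tour of a spanning tree\<close>

abbreviation adj :: "'a set set \<Rightarrow> ('a \<times> 'a) set" where
  "adj T \<equiv> {(u, w). {u, w} \<in> T}"

text \<open>\<open>B\<close> is a union of components of \<open>T\<close> without \<open>c\<close>.
  Whether \<open>c\<close> itself crosses is left open; where it matters, membership of its ends is
  assumed separately.\<close>

definition separates :: "'a set set \<Rightarrow> 'a set \<Rightarrow> 'a set \<Rightarrow> bool" where
  "separates T c B \<longleftrightarrow> (\<forall>u w. {u, w} \<in> T \<longrightarrow> {u, w} \<noteq> c \<longrightarrow> (u \<in> B \<longleftrightarrow> w \<in> B))"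

definition darts :: "'a set set \<Rightarrow> ('a \<times> 'a set) set" where
  "darts G = {(x, a). a \<in> G \<and> x \<in> a}"

lemma other_end_doubleton [simp]: "other_end x {x, y} = y" "other_end y {x, y} = x"
  unfolding other_end_def by (rule the_equality; auto simp: doubleton_eq_iff)+

text \<open>Acyclicity enters as \<open>bridge\<close>: every edge of \<open>T\<close> has a side
  that no other edge of \<open>T\<close> leaves. This is the form in which the tour can use
  it.\<close>

locale ribbon_tree =
  fixes G T :: "'a::finite set set" and \<rho> :: "'a \<Rightarrow> 'a set \<Rightarrow> 'a set" and s :: "'a \<times> 'a set"
  assumes edge: "a \<in> G \<Longrightarrow> \<exists>x y. x \<noteq> y \<and> a = {x, y}"
    and ribbon: "cyclic_on (\<rho> x) {a \<in> G. x \<in> a}"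
    and subgraph: "T \<subseteq> G"
    and connected: "(x, y) \<in> (adj T)\<^sup>*"
    and bridge: "{x, y} \<in> T \<Longrightarrow> \<exists>B. x \<notin> B \<and> y \<in> B \<and> separates T {x, y} B"
    and base: "s \<in> darts G"
begin

section \<open>The tour step as a permutation of half-edges\<close>

abbreviation f where "f \<equiv> tour_step \<rho> T"

lemma rho_darts: "(x, a) \<in> darts G \<Longrightarrow> (x, \<rho> x a) \<in> darts G"
  using cyclic_on_f_in[OF _ ribbon] cyclic_on_inI[OF ribbon] by (fastforce simp: darts_def)

text \<open>Each edge at \<open>x\<close> lies in its own \<open>\<rho> x\<close>-orbit, hence is an
  image; a surjection of a finite set onto itself is injective.\<close>

lemma inj_rho: "inj_on (\<rho> x) {a \<in> G. x \<in> a}"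
proof -
  have orbit: "orbit (\<rho> x) b = {a \<in> G. x \<in> a}" if "b \<in> G" "x \<in> b" for b
    using ribbon[of x] that by (simp add: cyclic_on_alldef)
  have "b \<in> \<rho> x ` {a \<in> G. x \<in> a}" if "b \<in> G" "x \<in> b" for b
  proof -
    have "b \<in> orbit (\<rho> x) b" using orbit that by simp
    then show ?thesis
      by cases (use orbit that in auto)
  qed
  then show ?thesis
    by (intro finite_surj_inj) auto
qed

lemma step_in:
  assumes "(x, a) \<in> darts G" "a \<in> T"
  obtains y where "y \<noteq> x" "a = {x, y}" "f (x, a) = (y, \<rho> y a)"
    "(y, a) \<in> darts G"
proof -
  obtain u w where "u \<noteq> w" "a = {u, w}" "x \<in> a"
    using edge[of a] assms(1) unfolding darts_def by blast
  then obtain y where y: "y \<noteq> x" "a = {x, y}"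
    by (metis empty_iff insert_commute insert_iff)
  have "f (x, a) = (y, \<rho> y a)" "(y, a) \<in> darts G"
    using assms y by (simp_all add: tour_step_def darts_def)
  then show ?thesis using that y by blast
qed

lemma step_out: "a \<notin> T \<Longrightarrow> f (x, a) = (x, \<rho> x a)"
  by (simp add: tour_step_def)

lemma step_darts: "d \<in> darts G \<Longrightarrow> f d \<in> darts G"
proof (cases d)
  case (Pair x a)
  assume d: "d \<in> darts G"
  show ?thesis
  proof (cases "a \<in> T")
    case True
    with d Pair obtain y where "f d = (y, \<rho> y a)" "(y, a) \<in> darts G"
      using step_in[of x a] by blast
    then show ?thesis by (simp add: rho_darts)
  next
    case False
    then show ?thesis using d Pair rho_darts by (simp add: step_out)
  qed
qed

text \<open>The step first reverses half-edges on \<open>T\<close> and fixes all others, then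
  rotates by \<open>\<rho>\<close>; both maps are injective. In \<open>rev\<close>, \<open>z\<close>
  is the node at which the rotation happens.\<close>

lemma inj_step: "inj_on f (darts G)"
proof (rule inj_onI)
  have rev: "\<exists>z. f (x, a) = (z, \<rho> z a) \<and> (z, a) \<in> darts G \<and> (a \<notin> T \<longrightarrow> x = z) \<and> (a \<in> T \<longrightarrow> a = {x, z})"
    if "(x, a) \<in> darts G" for x a
  proof (cases "a \<in> T")
    case True
    then show ?thesis using step_in[OF that True] by blast
  qed (use that in \<open>simp add: step_out\<close>)
  fix d e assume de: "d \<in> darts G" "e \<in> darts G" "f d = f e"
  obtain x a y b where d: "d = (x, a)" and e: "e = (y, b)" by (cases d, cases e)
  obtain z where z: "f d = (z, \<rho> z a)" "(z, a) \<in> darts G" "a \<notin> T \<longrightarrow> x = z" "a \<in> T \<longrightarrow> a = {x, z}"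
    using rev[of x a] de(1) unfolding d by blast
  obtain z' where z': "f e = (z', \<rho> z' b)" "(z', b) \<in> darts G" "b \<notin> T \<longrightarrow> y = z'" "b \<in> T \<longrightarrow> b = {y, z'}"
    using rev[of y b] de(2) unfolding e by blast
  have zz: "z = z'" "\<rho> z a = \<rho> z b" using z(1) z'(1) de(3) by auto
  have ab: "a = b"
    by (rule inj_onD[OF inj_rho zz(2)]) (use z(2) z'(2) zz(1) in \<open>simp_all add: darts_def\<close>)
  show "d = e"
  proof (cases "a \<in> T")
    case True
    then have "{x, z} = {y, z}" using z(4) z'(4) ab zz by simp
    then show ?thesis using d e ab by (auto simp: doubleton_eq_iff)
  next
    case False
    then show ?thesis using z(3) z'(3) ab zz d e by simp
  qed
qed

lemma funpow_darts: "d \<in> darts G \<Longrightarrow> (f ^^ n) d \<in> darts G"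
  by (induction n) (auto simp: step_darts)

text \<open>By injectivity the first \<open>i\<close> steps can be cancelled, so an orbit that
  repeats closes up at its starting point.\<close>

lemma funpow_cancel:
  assumes "d \<in> darts G" "i \<le> j" "(f ^^ i) d = (f ^^ j) d"
  shows "(f ^^ (j - i)) d = d"
  using assms(2,3)
proof (induction i arbitrary: j)
  case (Suc i)
  then obtain j' where j: "j = Suc j'" by (cases j) auto
  have "(f ^^ i) d = (f ^^ j') d"
    using Suc.prems j inj_onD[OF inj_step] funpow_darts[OF assms(1)] by auto
  then show ?case using Suc j by auto
qed auto

lemma returns:
  assumes "d \<in> darts G" obtains n where "0 < n" "(f ^^ n) d = d"
proof -
  have "\<not> inj (\<lambda>n. (f ^^ n) d)"
    using finite_subset[of "range (\<lambda>n. (f ^^ n) d)" "darts G"] funpow_darts[OF assms]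
    by (metis finite finite_imageD infinite_UNIV_nat)
  then obtain i j where "i < j" "(f ^^ i) d = (f ^^ j) d"
    unfolding inj_def by (metis linorder_neqE_nat)
  then show ?thesis using that[of "j - i"] funpow_cancel[OF assms] by auto
qed

text \<open>The tour changes node only along edges of \<open>T\<close>, and \<open>{x, y}\<close> is
  the only one that can leave \<open>B\<close>. As \<open>x\<close> is outside, the sole exit is the
  half-edge at \<open>y\<close>.\<close>

lemma step_stays_inside:
  assumes "separates T {x, y} B" "x \<notin> B" "d \<in> darts G" "fst d \<in> B" "d \<noteq> (y, {x, y})"
  shows "fst (f d) \<in> B"
proof (cases d)
  case (Pair z a)
  show ?thesis
  proof (cases "a \<in> T")
    case True
    obtain w where w: "a = {z, w}" "f (z, a) = (w, \<rho> w a)"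
      using step_in[OF _ True] assms(3) Pair by blast
    show ?thesis
    proof (cases "a = {x, y}")
      case True
      then have "z = x" using w(1) assms(5) Pair by (auto simp: doubleton_eq_iff)
      then show ?thesis using assms(2,4) Pair by simp
    next
      case False
      then have "z \<in> B \<longleftrightarrow> w \<in> B"
        using w(1) assms(1) True unfolding separates_def by blast
      then show ?thesis using w assms(4) Pair by simp
    qed
  qed (use Pair assms in \<open>simp add: step_out\<close>)
qed

lemma separates_commute: "separates T {x, y} B \<longleftrightarrow> separates T {y, x} (- B)"
  unfolding separates_def by (auto simp: insert_commute)

lemma step_stays_outside:
  assumes "separates T {x, y} B" "y \<in> B" "d \<in> darts G" "fst d \<notin> B" "d \<noteq> (x, {x, y})"
  shows "fst (f d) \<notin> B"
proof -
  have "separates T {y, x} (- B)"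
    using assms(1) separates_commute by blast
  from step_stays_inside[OF this] show ?thesis
    using assms(2-5) by (simp add: insert_commute)
qed

section \<open>Every half-edge is visited\<close>

definition visited :: "('a \<times> 'a set) set" where "visited = range (\<lambda>n. (f ^^ n) s)"

lemma visited_step: "d \<in> visited \<Longrightarrow> f d \<in> visited"
proof -
  assume "d \<in> visited"
  then obtain n where "d = (f ^^ n) s" by (auto simp: visited_def)
  then have "f d = (f ^^ Suc n) s" by simp
  then show ?thesis unfolding visited_def by blast
qed

lemma visited_funpow: "d \<in> visited \<Longrightarrow> (f ^^ n) d \<in> visited"
  by (induction n) (auto simp: visited_step)

lemma visited_darts: "visited \<subseteq> darts G"
  using funpow_darts[OF base] by (auto simp: visited_def)

text \<open>An excursion across a tree edge has to come back, and it can only come back across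
  the same edge.\<close>

lemma visited_rotate:
  assumes "(x, a) \<in> visited" shows "(x, \<rho> x a) \<in> visited"
proof (cases "a \<in> T")
  case False
  then show ?thesis using visited_step[OF assms] by (simp add: step_out)
next
  case True
  have d: "(x, a) \<in> darts G" using assms visited_darts by auto
  obtain y where y: "y \<noteq> x" "a = {x, y}" "f (x, a) = (y, \<rho> y a)"
    using step_in[OF d True] by blast
  obtain B where B: "x \<notin> B" "y \<in> B" "separates T {x, y} B"
    using bridge[of x y] True y(2) by blast
  have "(y, a) \<in> visited"
  proof (rule ccontr)
    assume no: "(y, a) \<notin> visited"
    have stay: "fst ((f ^^ Suc n) (x, a)) \<in> B" for n
    proof (induction n)
      case 0
      then show ?case using y B by simp
    next
      case (Suc n)
      have "(f ^^ Suc n) (x, a) \<in> visited" using visited_funpow assms by blast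
      then show ?case
        using step_stays_inside[OF B(3,1) _ Suc] visited_darts no y(2) by (metis funpow.simps(2) o_apply subsetD)
    qed
    obtain n where n: "0 < n" "(f ^^ n) (x, a) = (x, a)" using returns[OF d] by blast
    then show False using B(1) stay[of "n - 1"] by simp
  qed
  \<comment> \<open>Stepping from \<open>(y, a)\<close> crosses back to \<open>x\<close> and rotates
    there, so it lands exactly on \<open>(x, \<rho> x a)\<close>.\<close>
  then have "f (y, a) \<in> visited" by (rule visited_step)
  then show ?thesis using y True by (simp add: tour_step_def)
qed

lemma visited_around:
  assumes "(x, a) \<in> visited" "(x, b) \<in> darts G" shows "(x, b) \<in> visited"
proof -
  have "a \<in> {a \<in> G. x \<in> a}" using assms(1) visited_darts by (auto simp: darts_def)
  then have "orbit (\<rho> x) a = {a \<in> G. x \<in> a}"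
    using ribbon[of x] by (simp add: cyclic_on_alldef)
  then have "b \<in> orbit (\<rho> x) a" using assms(2) by (auto simp: darts_def)
  then show ?thesis
    by induction (auto intro: visited_rotate assms(1))
qed

text \<open>A visited node has all its half-edges visited, among them those on edges of
  \<open>T\<close>, across which the tour moves on; connectivity of \<open>T\<close> then reaches
  every node.\<close>

lemma visited_eq: "visited = darts G"
proof
  show "darts G \<subseteq> visited"
  proof
    fix d assume d: "d \<in> darts G"
    have s: "(fst s, snd s) \<in> visited"
      unfolding visited_def using rangeI[of "\<lambda>n. (f ^^ n) s" 0] by simp
    have "\<exists>a. (z, a) \<in> visited" if "(fst s, z) \<in> (adj T)\<^sup>*" for z
      using that
    proof (induction rule: rtrancl_induct)
      case base
      then show ?case using s by blast
    next
      case (step y z)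
      then obtain a where a: "(y, a) \<in> visited" by blast
      have e: "{y, z} \<in> T" using step by auto
      then have "(y, {y, z}) \<in> visited"
        using visited_around[OF a] subgraph by (auto simp: darts_def)
      from visited_step[OF this] show ?case
        using e by (auto simp: tour_step_def)
    qed
    then show "d \<in> visited"
      using connected[of "fst s" "fst d"] visited_around d by (metis prod.collapse)
  qed
qed (rule visited_darts)

section \<open>Positions in the tour\<close>

definition period where
  "period = tour_length \<rho> T s"

lemma period: "0 < period" "(f ^^ period) s = s"
  using LeastI_ex[of "\<lambda>n. 0 < n \<and> (f ^^ n) s = s"] returns[OF base]
  unfolding period_def tour_length_def by blast+

lemma inj_tour: "inj_on (\<lambda>n. (f ^^ n) s) {..<period}"
proof -
  have "i = j" if "i \<le> j" "j < period" "(f ^^ i) s = (f ^^ j) s" for i j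
    using not_less_Least[of "j - i" "\<lambda>n. 0 < n \<and> (f ^^ n) s = s"] that(1,2)
      funpow_cancel[OF base that(1,3)] unfolding period_def tour_length_def by linarith
  then show ?thesis
    by (intro inj_onI) (metis lessThan_iff nat_le_linear)
qed

lemma tour_unique: "i < period \<Longrightarrow> j < period \<Longrightarrow> (f ^^ i) s = (f ^^ j) s \<Longrightarrow> i = j"
  using inj_onD[OF inj_tour] by blast

lemma tour_add_period: "(f ^^ (i + period)) s = (f ^^ i) s"
  by (simp add: funpow_add period)

lemma tour_mod: "(f ^^ (i mod period)) s = (f ^^ i) s"
  using period by (simp add: funpow_mod_eq)

lemma tour_index:
  assumes "d \<in> darts G" obtains i where "i < period" "(f ^^ i) s = d"
proof -
  obtain n where "(f ^^ n) s = d" using assms unfolding visited_eq[symmetric] visited_def by blast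
  then show ?thesis using that[of "n mod period"] tour_mod period by auto
qed

text \<open>The length does not depend on \<open>T\<close>, so tours of different trees can be
  compared position by position.\<close>

lemma period_eq_card: "period = card (darts G)"
proof -
  have "(\<lambda>n. (f ^^ n) s) ` {..<period} = darts G"
    using tour_index funpow_darts[OF base] by (auto simp: image_iff) (metis lessThan_iff)
  then show ?thesis using card_image[OF inj_tour] by simp
qed

lemma cut_at_iff:
  "cut_at \<rho> T s a x \<longleftrightarrow>
    (\<exists>i j. i < j \<and> j < period \<and> (f ^^ i) s = (x, a) \<and> (f ^^ j) s = (other_end x a, a))"
  unfolding cut_at_def tour_def period_def by (fastforce simp del: add_0)

text \<open>The step from position \<open>n\<close> enters \<open>B\<close>, and the only exit is
  the half-edge at position \<open>m\<close>; afterwards \<open>B\<close> is entered again only when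
  position \<open>n\<close> recurs. The interval is half-open because the node at \<open>n\<close>
  is still \<open>x\<close> and the one at \<open>m\<close> is still \<open>y\<close>.\<close>

lemma tour_side:
  assumes c: "{x, y} \<in> T" and nm: "n < m" "m < period"
    and n: "(f ^^ n) s = (x, {x, y})" and m: "(f ^^ m) s = (y, {x, y})"
    and B: "x \<notin> B" "y \<in> B" "separates T {x, y} B" and i: "i < period"
  shows "fst ((f ^^ i) s) \<in> B \<longleftrightarrow> n < i \<and> i \<le> m"
proof -
  have inside: "fst ((f ^^ (Suc n + k)) s) \<in> B" if "Suc n + k \<le> m" for k
    using that
  proof (induction k)
    case 0
    then show ?case using c n B by (simp add: tour_step_def)
  next
    case (Suc k)
    have "(f ^^ (Suc n + k)) s \<noteq> (y, {x, y})"
      using tour_unique[of "Suc n + k" m] Suc.prems nm m by auto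
    then show ?case
      using step_stays_inside[OF B(3,1) funpow_darts[OF base, of "Suc n + k"]] Suc
      by (simp del: funpow.simps add: funpow.simps(2)[of "Suc (n + k)"])
  qed
  \<comment> \<open>This stretch runs past the end of the tour to the recurrence of position
    \<open>n\<close>, and so covers both the end and the beginning of the tour.\<close>
  have outside: "fst ((f ^^ (Suc m + k)) s) \<notin> B" if "Suc m + k \<le> n + period" for k
    using that
  proof (induction k)
    case 0
    then show ?case using c m B by (simp add: tour_step_def)
  next
    case (Suc k)
    have "(f ^^ (Suc m + k)) s \<noteq> (x, {x, y})"
    proof (cases "Suc m + k < period")
      case True
      then show ?thesis using tour_unique[of "Suc m + k" n] nm n by auto
    next
      case False
      then have "(f ^^ (Suc m + k)) s = (f ^^ (Suc m + k - period)) s"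
        using tour_add_period[of "Suc m + k - period"] by simp
      moreover have "Suc m + k - period < n" using Suc.prems nm False by linarith
      ultimately show ?thesis
        using tour_unique[of "Suc m + k - period" n] nm n by (metis less_trans less_irrefl)
    qed
    then show ?case
      using step_stays_outside[OF B(3,2) funpow_darts[OF base, of "Suc m + k"]] Suc
      by (simp del: funpow.simps add: funpow.simps(2)[of "Suc (m + k)"])
  qed
  consider "i \<le> n" | "n < i" "i \<le> m" | "m < i" by linarith
  then show ?thesis
  proof cases
    case 1
    then show ?thesis using outside[of "i + period - Suc m"] nm tour_add_period[of i] by auto
  next
    case 2
    then show ?thesis using inside[of "i - Suc n"] by auto
  next
    case 3
    then show ?thesis using outside[of "i - Suc m"] i by auto
  qed
qed

text \<open>After \<open>n\<close>, the outside of \<open>B\<close> is visited only after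
  \<open>m\<close>, while the inside is visited only up to \<open>m\<close>; so
  \<open>l \<le> m < k\<close>.\<close>

lemma tour_crossing:
  assumes c: "{x, y} \<in> T" and nm: "n < m" "m < period"
    and n: "(f ^^ n) s = (x, {x, y})" and m: "(f ^^ m) s = (y, {x, y})"
    and B: "x \<notin> B" "y \<in> B" "separates T {x, y} B"
    and a: "{u, w} \<in> G" "u \<notin> B" "w \<in> B"
    and k: "k < period" "n < k" "(f ^^ k) s = (u, {u, w})"
    and l: "l < period" "(f ^^ l) s = (w, {u, w})"
  shows "l < k"
  using tour_side[OF c nm n m B, of k] tour_side[OF c nm n m B, of l] a k l by auto

end

section \<open>Spanning trees as bases of the edge space\<close>

lemma adj_commute: "(x, y) \<in> (adj T)\<^sup>* \<Longrightarrow> (y, x) \<in> (adj T)\<^sup>*"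
  by (rule symD[OF sym_rtrancl]) (auto simp: sym_def insert_commute)

lemma adj_extend:
  assumes "{u, w} \<in> T" shows "(x, u) \<in> (adj T)\<^sup>* \<longleftrightarrow> (x, w) \<in> (adj T)\<^sup>*"
proof -
  have "(u, w) \<in> adj T" "(w, u) \<in> adj T" using assms by (auto simp: insert_commute)
  then show ?thesis
    using rtrancl_into_rtrancl[of x u "adj T" w] rtrancl_into_rtrancl[of x w "adj T" u] by blast
qed

lemma adj_separates: "separates T c {z. (x, z) \<in> (adj (T - {c}))\<^sup>*}"
  unfolding separates_def using adj_extend[where T = "T - {c}"] by blast

text \<open>\<open>B\<close> is the component of \<open>y\<close> without the edge. If it contained
  \<open>x\<close>, a simple path from \<open>y\<close> to \<open>x\<close> would close up with the
  edge to a cycle.\<close>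

lemma bridge_if_acyclic:
  assumes acyclic: "\<nexists>xs. graph_cycle T xs" and c: "{x, y} \<in> T" "x \<noteq> y"
  shows "\<exists>B. x \<notin> B \<and> y \<in> B \<and> separates T {x, y} B"
proof -
  let ?r = "\<lambda>u w. {u, w} \<in> T - {{x, y}}"
  define B where "B = {z. ?r\<^sup>*\<^sup>* y z}"
  have "x \<notin> B"
  proof
    assume "x \<in> B"
    then obtain xs where xs: "rtrancl_path ?r y xs x" "distinct (y # xs)"
      unfolding B_def rtranclp_eq_rtrancl_path by (auto elim: rtrancl_path_distinct)
    have nonempty: "xs \<noteq> []" using xs(1) c(2) by (auto elim: rtrancl_path.cases)
    then have last: "last xs = x" using rtrancl_path_last xs(1) by metis
    have edge: "?r ((y # xs) ! i) (xs ! i)" if "i < length xs" for i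
      using rtrancl_path_nth[OF xs(1) that] .
    \<comment> \<open>A path of length one would be the removed edge itself, so the cycle has at
      least three nodes.\<close>
    have "length xs \<noteq> 1"
    proof
      assume "length xs = 1"
      then have "xs ! 0 = x" using last nonempty by (simp add: last_conv_nth)
      then show False using edge[of 0] nonempty by (simp add: insert_commute)
    qed
    then have len: "3 \<le> length (y # xs)" using nonempty by (cases xs rule: list.exhaust) (auto simp: Suc_le_eq)
    have "graph_cycle T (y # xs)"
      unfolding graph_cycle_def
    proof (intro conjI allI impI)
      fix i assume i: "i < length (y # xs)"
      show "{(y # xs) ! i, (y # xs) ! (Suc i mod length (y # xs))} \<in> T"
      proof (cases "i = length xs")
        case True
        then have "(y # xs) ! i = x" using last nonempty by (simp add: last_conv_nth nth_Cons')
        then show ?thesis using True c by simp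
      next
        case False
        then show ?thesis using i edge[of i] by simp
      qed
    qed (use len xs in auto)
    then show False using acyclic by blast
  qed
  moreover have "y \<in> B" by (simp add: B_def)
  moreover have "separates T {x, y} B"
    unfolding separates_def
  proof (intro allI impI iffI)
    fix u w assume uw: "{u, w} \<in> T" "{u, w} \<noteq> {x, y}"
    then have "?r u w" "?r w u" by (auto simp: insert_commute)
    then show "u \<in> B \<Longrightarrow> w \<in> B" "w \<in> B \<Longrightarrow> u \<in> B"
      unfolding B_def by (auto intro: rtranclp.rtrancl_into_rtrancl)
  qed
  ultimately show ?thesis by blast
qed

text \<open>Take the side of the first edge of a cycle. The other edges cannot leave it, yet the
  closing edge returns to the start, which is outside.\<close>

lemma acyclic_if_bridges:
  assumes bridge: "\<And>x y. {x, y} \<in> T \<Longrightarrow> \<exists>B. x \<notin> B \<and> y \<in> B \<and> separates T {x, y} B"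
  shows "\<nexists>xs. graph_cycle T xs"
proof
  assume "\<exists>xs. graph_cycle T xs"
  then obtain xs where xs: "3 \<le> length xs" "distinct xs"
    "\<And>i. i < length xs \<Longrightarrow> {xs ! i, xs ! (Suc i mod length xs)} \<in> T"
    unfolding graph_cycle_def by blast
  have ne: "xs \<noteq> []" using xs(1) by auto
  have "{xs ! 0, xs ! 1} \<in> T" using xs(1) xs(3)[of 0] by (cases "xs = []") auto
  then obtain B where B: "xs ! 0 \<notin> B" "xs ! 1 \<in> B" "separates T {xs ! 0, xs ! 1} B"
    using bridge by blast
  have neq: "xs ! i \<noteq> xs ! j" if "i < length xs" "j < length xs" "i \<noteq> j" for i j
    using nth_eq_iff_index_eq[OF xs(2)] that by blast
  have "xs ! Suc i \<in> B" if "Suc i < length xs" for i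
    using that
  proof (induction i)
    case 0
    then show ?case using B by simp
  next
    case (Suc i)
    have "{xs ! Suc i, xs ! Suc (Suc i)} \<in> T" using xs(3)[of "Suc i"] Suc.prems by simp
    moreover have "{xs ! Suc i, xs ! Suc (Suc i)} \<noteq> {xs ! 0, xs ! 1}"
      using neq[of "Suc (Suc i)" 0] neq[of "Suc (Suc i)" 1] Suc.prems ne
      by (auto simp: doubleton_eq_iff)
    ultimately show ?case using B(3) Suc unfolding separates_def by auto
  qed
  moreover have "Suc (length xs - 2) = length xs - 1" using xs(1) by linarith
  ultimately have "xs ! (length xs - 1) \<in> B"
    using xs(1) by (metis diff_less ne length_greater_0_conv zero_less_one)
  moreover have "{xs ! (length xs - 1), xs ! 0} \<in> T"
    using ne xs(3)[of "length xs - 1"] by (metis Suc_pred' diff_less length_greater_0_conv mod_self zero_less_one)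
  moreover have "{xs ! (length xs - 1), xs ! 0} \<noteq> {xs ! 0, xs ! 1}"
  proof -
    have "length xs - 1 < length xs" "length xs - 1 \<noteq> 0" "length xs - 1 \<noteq> 1" "1 < length xs"
      using xs(1) by linarith+
    then show ?thesis
      using neq[of "length xs - 1" 0] neq[of "length xs - 1" 1] ne
      unfolding doubleton_eq_iff by (metis length_greater_0_conv)
  qed
  ultimately show False using B unfolding separates_def by blast
qed

section \<open>Edge vectors and flow functionals\<close>

definition edge_vec :: "'n set \<Rightarrow> real ^ 'n::finite" where
  "edge_vec a = (\<chi> x. if x \<in> a then 1 else 0)"

lemma edge_vec_doubleton: "x \<noteq> y \<Longrightarrow> edge_vec {x, y} = axis x 1 + axis y 1"
  by (auto simp: edge_vec_def vec_eq_iff axis_def)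

lemma inj_edge_vec: "inj edge_vec"
  by (rule injI) (auto simp: edge_vec_def vec_eq_iff split: if_splits)

lemma convex_hull_edge_vec:
  "convex hull (edge_vec ` T) =
     {z. \<exists>u. (\<forall>a\<in>T. 0 \<le> u a) \<and> sum u T = 1 \<and> z = (\<Sum>a\<in>T. u a *\<^sub>R edge_vec a)}" (is "?l = ?r")
proof (intro set_eqI iffI)
  have inj: "inj_on edge_vec T" using inj_edge_vec by (rule inj_on_subset) simp
  fix z
  {
    assume "z \<in> ?l"
    then obtain u where "\<forall>x\<in>edge_vec ` T. 0 \<le> u x" "sum u (edge_vec ` T) = 1"
      "(\<Sum>x\<in>edge_vec ` T. u x *\<^sub>R x) = z"
      by (auto simp: convex_hull_finite)
    then show "z \<in> ?r"
      using inj by (auto simp: sum.reindex intro!: exI[of _ "u \<circ> edge_vec"])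
  next
    assume "z \<in> ?r"
    then obtain u where "\<forall>a\<in>T. 0 \<le> u a" "sum u T = 1" "z = (\<Sum>a\<in>T. u a *\<^sub>R edge_vec a)"
      by blast
    moreover from this have "(\<Sum>a\<in>T. u a *\<^sub>R edge_vec a) \<in> convex hull (edge_vec ` T)"
      by (intro convex_sum[OF _ convex_convex_hull]) (auto intro: hull_inc)
    ultimately show "z \<in> ?l" by simp
  }
qed

locale bipartite =
  fixes E :: "'n::finite set" and G :: "'n set set"
  assumes edges: "a \<in> G \<Longrightarrow> \<exists>e v. e \<in> E \<and> v \<notin> E \<and> a = {e, v}"
    and G_connected: "(x, y) \<in> (adj G)\<^sup>*"
begin

definition sg :: "'n \<Rightarrow> real" where "sg x = (if x \<in> E then 1 else -1)"

text \<open>The opposite signs at the ends of an edge make this vanish on edges within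
  \<open>B\<close> and on edges avoiding \<open>B\<close>; only edges across the boundary
  count.\<close>

definition flow :: "'n set \<Rightarrow> real ^ 'n \<Rightarrow> real" where
  "flow B z = (\<Sum>x\<in>B. sg x * z $ x)"

text \<open>Linear-algebra form of a spanning tree (see \<open>spanning_tree_iff\<close>), in which
  exchange and extension of bases are available.\<close>

definition tree_basis :: "'n set set \<Rightarrow> bool" where
  "tree_basis T \<longleftrightarrow> T \<subseteq> G \<and> independent (edge_vec ` T) \<and> edge_vec ` G \<subseteq> span (edge_vec ` T)"

lemma edgeE:
  assumes "a \<in> G" obtains e v where "e \<in> E" "v \<notin> E" "e \<noteq> v" "a = {e, v}" "{e, v} \<in> G"
  using edges[OF assms] assms by blast

lemma edge_sg: "{x, y} \<in> G \<Longrightarrow> sg y = - sg x \<and> x \<noteq> y"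
  using edges[of "{x, y}"] by (auto simp: sg_def doubleton_eq_iff)

lemma sg_sq [simp]: "sg x * sg x = 1" and sg_nz [simp]: "sg x \<noteq> 0"
  by (auto simp: sg_def)

lemma linear_flow: "linear (flow B)"
  by (rule linearI) (simp_all add: flow_def sum.distrib distrib_left sum_distrib_left mult.left_commute)

lemma flow_axis: "flow B (axis x 1) = (if x \<in> B then sg x else 0)"
  unfolding flow_def by (simp add: axis_def if_distrib[of "(*) _"] sum.delta' cong: if_cong)

lemma flow_edge:
  "{x, y} \<in> G \<Longrightarrow> flow B (edge_vec {x, y}) = sg x * (of_bool (x \<in> B) - of_bool (y \<in> B))"
  using edge_sg[of x y] by (auto simp: edge_vec_doubleton linear_add[OF linear_flow] flow_axis)

lemma flow_sum: "flow B (\<Sum>a\<in>T. c a *\<^sub>R edge_vec a) = (\<Sum>a\<in>T. c a * flow B (edge_vec a))"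
  by (simp add: linear_sum[OF linear_flow] linear_scale[OF linear_flow])

text \<open>Only \<open>{x, y}\<close> crosses the boundary of \<open>B\<close> in \<open>T\<close>,
  so the functional reads off its coefficient up to sign.\<close>

lemma flow_tree_edge:
  assumes "T \<subseteq> G" "{x, y} \<in> T" "x \<notin> B" "y \<in> B" "separates T {x, y} B"
  shows "flow B (\<Sum>a\<in>T. c a *\<^sub>R edge_vec a) = c {x, y} * sg y"
proof -
  have "flow B (edge_vec a) = (if a = {x, y} then sg y else 0)" if aT: "a \<in> T" for a
  proof -
    obtain e v where a: "a = {e, v}" by (rule edgeE[OF subsetD[OF assms(1) aT]]) (rule that)
    have "a \<noteq> {x, y} \<Longrightarrow> e \<in> B \<longleftrightarrow> v \<in> B"
      using assms(5) aT a unfolding separates_def by blast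
    then show ?thesis
      using flow_edge[of e v B] flow_edge[of x y B] edge_sg[of x y] a aT assms(1-4)
      by (cases "a = {x, y}") auto
  qed
  then have "flow B (\<Sum>a\<in>T. c a *\<^sub>R edge_vec a) = (\<Sum>a\<in>T. if a = {x, y} then c a * sg y else 0)"
    unfolding flow_sum by (intro sum.cong) auto
  then show ?thesis using assms(2) by simp
qed

text \<open>The signed edge vectors telescope along a path, since the signs of consecutive nodes
  alternate.\<close>

lemma path_span:
  assumes "T \<subseteq> G" "(x, y) \<in> (adj T)\<^sup>*"
  shows "sg x *\<^sub>R axis x 1 - sg y *\<^sub>R axis y 1 \<in> span (edge_vec ` T)"
  using assms(2)
proof (induction rule: rtrancl_induct)
  case base
  then show ?case by (simp add: span_zero)
next
  case (step y z)
  then have yz: "{y, z} \<in> T" by simp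
  then have "sg y *\<^sub>R edge_vec {y, z} \<in> span (edge_vec ` T)"
    by (intro span_scale span_base) simp
  moreover have "sg y *\<^sub>R edge_vec {y, z} = sg y *\<^sub>R axis y 1 - sg z *\<^sub>R axis z 1"
    using edge_sg[of y z] yz assms(1) by (auto simp: edge_vec_doubleton algebra_simps)
  ultimately show ?case using span_add[OF step.IH] by force
qed

lemma edge_in_span:
  assumes "T \<subseteq> G" "{x, y} \<in> G" "(x, y) \<in> (adj T)\<^sup>*"
  shows "edge_vec {x, y} \<in> span (edge_vec ` T)"
proof -
  have "sg x *\<^sub>R (sg x *\<^sub>R axis x 1 - sg y *\<^sub>R axis y 1) \<in> span (edge_vec ` T)"
    using path_span[OF assms(1,3)] by (rule span_scale)
  moreover have "sg x *\<^sub>R (sg x *\<^sub>R axis x 1 - sg y *\<^sub>R axis y 1) = edge_vec {x, y}"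
    using edge_sg[OF assms(2)] by (simp add: edge_vec_doubleton algebra_simps scaleR_diff_right)
  ultimately show ?thesis by metis
qed

text \<open>Were \<open>x\<close> and \<open>y\<close> still joined without their edge, its vector
  would be in the span of the others.\<close>

lemma tree_basis_bridge:
  assumes T: "tree_basis T" and c: "{x, y} \<in> T"
  shows "\<exists>B. x \<notin> B \<and> y \<in> B \<and> separates T {x, y} B"
proof -
  let ?B = "{z. (y, z) \<in> (adj (T - {{x, y}}))\<^sup>*}"
  have TG: "T \<subseteq> G" using T by (simp add: tree_basis_def)
  have "x \<notin> ?B"
  proof
    assume "x \<in> ?B"
    then have "(x, y) \<in> (adj (T - {{x, y}}))\<^sup>*"
      using adj_commute[of y x "T - {{x, y}}"] by blast
    moreover have "T - {{x, y}} \<subseteq> G" "{x, y} \<in> G" using TG c by blast+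
    ultimately have "edge_vec {x, y} \<in> span (edge_vec ` (T - {{x, y}}))"
      using edge_in_span by blast
    moreover have "edge_vec ` (T - {{x, y}}) = edge_vec ` T - {edge_vec {x, y}}"
      by (simp add: image_set_diff[OF inj_edge_vec])
    ultimately show False
      using T c unfolding tree_basis_def dependent_def by (metis imageI)
  qed
  moreover have "y \<in> ?B" by simp
  ultimately show ?thesis using adj_separates[of T "{x, y}" y] by (intro exI[of _ ?B] conjI)
qed

text \<open>The flow of the component of \<open>x\<close> vanishes on \<open>T\<close>, hence on the
  span and so on all of \<open>G\<close>. No edge of \<open>G\<close> then leaves the component, and
  \<open>G\<close> is connected.\<close>

lemma tree_basis_connected:
  assumes T: "tree_basis T" shows "(x, y) \<in> (adj T)\<^sup>*"
proof -
  let ?B = "{z. (x, z) \<in> (adj T)\<^sup>*}"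
  have TG: "T \<subseteq> G" using T by (simp add: tree_basis_def)
  have sep: "u \<in> ?B \<longleftrightarrow> w \<in> ?B" if "{u, w} \<in> T" for u w
    using adj_extend[OF that] by blast
  have "flow ?B z = 0" if z: "z \<in> edge_vec ` T" for z
  proof -
    obtain a where a: "a \<in> T" "z = edge_vec a" using z by blast
    obtain e v where "a = {e, v}" by (rule edgeE[OF subsetD[OF TG a(1)]]) (rule that)
    with a have "z = edge_vec {e, v}" "{e, v} \<in> T" by simp_all
    then show ?thesis using sep[of e v] flow_edge[of e v ?B] TG by auto
  qed
  then have zero: "flow ?B (edge_vec a) = 0" if "a \<in> G" for a
    using linear_eq_0_on_span[OF linear_flow] T that unfolding tree_basis_def by blast
  have "y \<in> ?B"
    using G_connected[of x y]
  proof (induction rule: rtrancl_induct)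
    case (step u w)
    then show ?case using zero[of "{u, w}"] flow_edge[of u w ?B] by (auto split: if_splits)
  qed simp
  then show ?thesis by simp
qed

text \<open>Paths in \<open>T\<close> give spanning; the bridge flows isolate each coefficient of a
  linear relation, which gives independence.\<close>

lemma tree_basis_if_bridges:
  assumes TG: "T \<subseteq> G" and connected: "\<And>x y. (x, y) \<in> (adj T)\<^sup>*"
    and bridge: "\<And>x y. {x, y} \<in> T \<Longrightarrow> \<exists>B. x \<notin> B \<and> y \<in> B \<and> separates T {x, y} B"
  shows "tree_basis T"
  unfolding tree_basis_def
proof (intro conjI)
  show "edge_vec ` G \<subseteq> span (edge_vec ` T)"
  proof
    fix z assume "z \<in> edge_vec ` G"
    then obtain a where a: "a \<in> G" "z = edge_vec a" by blast
    obtain e v where "a = {e, v}" by (rule edgeE[OF a(1)]) (rule that)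
    then show "z \<in> span (edge_vec ` T)" using edge_in_span[OF TG _ connected] a by simp
  qed
  have "c b = 0" if z: "(\<Sum>a\<in>T. c a *\<^sub>R edge_vec a) = 0" and b: "b \<in> T" for c b
  proof -
    obtain x y where b': "b = {x, y}"
      by (rule edgeE[OF subsetD[OF TG b]]) (rule that)
    obtain B where "x \<notin> B" "y \<in> B" "separates T {x, y} B" using bridge b b' by blast
    from flow_tree_edge[OF TG b[unfolded b'] this, of c] show ?thesis
      using z b' linear_0[OF linear_flow] by simp
  qed
  then have "u (edge_vec b) = 0"
    if "(\<Sum>v\<in>edge_vec ` T. u v *\<^sub>R v) = 0" "b \<in> T" for u b
    using that inj_on_subset[OF inj_edge_vec, of T] by (simp add: sum.reindex)
  then show "independent (edge_vec ` T)"
    by (subst dependent_finite) auto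
qed (rule TG)

lemma spanning_tree_iff: "spanning_tree UNIV G T \<longleftrightarrow> tree_basis T"
proof
  assume T: "spanning_tree UNIV G T"
  then have TG: "T \<subseteq> G" and "\<And>x y. (x, y) \<in> (adj T)\<^sup>*" "\<nexists>xs. graph_cycle T xs"
    by (auto simp: spanning_tree_def graph_connected_def)
  then show "tree_basis T"
    using edge_sg by (intro tree_basis_if_bridges bridge_if_acyclic) blast+
next
  assume T: "tree_basis T"
  then show "spanning_tree UNIV G T"
    using acyclic_if_bridges[OF tree_basis_bridge[OF T]] tree_basis_connected[OF T]
    by (auto simp: spanning_tree_def graph_connected_def tree_basis_def)
qed

section \<open>Simplices of trees and their exchange\<close>

lemma total_edge:
  assumes "a \<in> G" shows "(\<Sum>x\<in>UNIV. edge_vec a $ x) = 2"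
proof -
  obtain e v where "e \<noteq> v" "a = {e, v}" 
    by (rule edgeE[OF assms]) (rule that)
  then show ?thesis by (simp add: edge_vec_doubleton sum.distrib axis_def)
qed

text \<open>Edge vectors lie on the hyperplane of coordinate sum 2, which misses the origin;
  comparing coordinate sums translates between linear and affine statements.\<close>

lemma total_sum:
  assumes "T \<subseteq> G"
  shows "(\<Sum>x\<in>UNIV. (\<Sum>a\<in>T. c a *\<^sub>R edge_vec a) $ x) = 2 * sum c T"
proof -
  have "(\<Sum>x\<in>UNIV. (\<Sum>a\<in>T. c a *\<^sub>R edge_vec a) $ x) = (\<Sum>a\<in>T. c a * (\<Sum>x\<in>UNIV. edge_vec a $ x))"
    by (simp add: sum_distrib_left sum.swap[of _ T])
  also have "\<dots> = (\<Sum>a\<in>T. c a * 2)"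
    using assms total_edge by (intro sum.cong) auto
  finally show ?thesis by (simp add: sum_distrib_right mult.commute)
qed

lemma tree_basis_expand:
  assumes T: "tree_basis T" and a: "a \<in> G"
  obtains c where "edge_vec a = (\<Sum>b\<in>T. c b *\<^sub>R edge_vec b)" "sum c T = 1"
proof -
  have "edge_vec a \<in> span (edge_vec ` T)" using T a by (auto simp: tree_basis_def)
  then obtain u where "edge_vec a = (\<Sum>x\<in>edge_vec ` T. u x *\<^sub>R x)"
    by (auto simp: span_finite)
  then have u: "edge_vec a = (\<Sum>b\<in>T. u (edge_vec b) *\<^sub>R edge_vec b)"
    using inj_on_subset[OF inj_edge_vec, of T] by (simp add: sum.reindex)
  then have "2 * (\<Sum>b\<in>T. u (edge_vec b)) = 2"
    using total_sum[of T "\<lambda>b. u (edge_vec b)"] total_edge[OF a] T by (simp add: tree_basis_def)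
  then show ?thesis using that[OF u] by simp
qed

text \<open>Taking coordinate sums in a linear relation shows that its coefficients sum to 0, so it
  is already an affine relation.\<close>

lemma edge_vecs_affine_dependent_iff:
  assumes "S \<subseteq> edge_vec ` G" shows "affine_dependent S \<longleftrightarrow> dependent S"
proof
  assume "dependent S"
  moreover have fin: "finite S" using assms by (rule finite_subset) simp
  ultimately obtain u where u: "\<exists>v\<in>S. u v \<noteq> 0" "(\<Sum>v\<in>S. u v *\<^sub>R v) = 0"
    by (auto simp: dependent_finite)
  obtain T where T: "T \<subseteq> G" "S = edge_vec ` T" using assms by (meson subset_imageE)
  have inj: "inj_on edge_vec T" using inj_on_subset[OF inj_edge_vec] by simp
  have "(\<Sum>a\<in>T. (u \<circ> edge_vec) a *\<^sub>R edge_vec a) = 0"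
    using u(2) T inj by (simp add: sum.reindex)
  then have "sum (u \<circ> edge_vec) T = 0"
    using total_sum[OF T(1), of "u \<circ> edge_vec"] by simp
  then have "sum u S = 0" using T inj by (simp add: sum.reindex)
  then show "affine_dependent S"
    using u fin by (auto simp: affine_dependent_explicit_finite)
qed (rule affine_dependent_imp_dependent)

lemma tree_basis_affine_independent:
  "tree_basis T \<Longrightarrow> \<not> affine_dependent (edge_vec ` T)"
  using edge_vecs_affine_dependent_iff[of "edge_vec ` T"] by (auto simp: tree_basis_def)

text \<open>By \<open>tree_basis_expand\<close> the edge vectors of \<open>G\<close> lie in the
  affine hull of those of \<open>T\<close>, so both hulls have the same dimension.\<close>

lemma tree_basis_simplex:
  assumes T: "tree_basis T"
  shows "aff_dim (convex hull (edge_vec ` G)) simplex (convex hull (edge_vec ` T))"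
proof (rule simplex_convex_hull, intro conjI)
  have "edge_vec ` G \<subseteq> affine hull (edge_vec ` T)"
  proof
    fix z assume "z \<in> edge_vec ` G"
    then obtain c where c: "z = (\<Sum>b\<in>T. c b *\<^sub>R edge_vec b)" "sum c T = 1"
      using tree_basis_expand[OF T] by blast
    have "inj_on edge_vec T" using inj_on_subset[OF inj_edge_vec] by simp
    then show "z \<in> affine hull (edge_vec ` T)"
      using c by (auto simp: affine_hull_finite sum.reindex inv_f_f[OF inj_edge_vec]
          intro!: exI[of _ "c \<circ> inv edge_vec"])
  qed
  then have "aff_dim (edge_vec ` G) \<le> aff_dim (edge_vec ` T)"
    using aff_dim_subset[of "edge_vec ` G" "affine hull (edge_vec ` T)"] by simp
  moreover have "aff_dim (edge_vec ` T) \<le> aff_dim (edge_vec ` G)"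
    using T by (intro aff_dim_subset image_mono) (simp add: tree_basis_def)
  ultimately show "int (card (edge_vec ` T)) = aff_dim (convex hull (edge_vec ` G)) + 1"
    using affine_independent_iff_card[THEN iffD1, OF tree_basis_affine_independent[OF T]]
    by (simp add: aff_dim_convex_hull)
qed (rule tree_basis_affine_independent[OF T])

lemma rel_interior_tree_simplex:
  assumes T: "tree_basis T" and z: "z \<in> rel_interior (convex hull (edge_vec ` T))"
  obtains u where "\<And>a. a \<in> T \<Longrightarrow> 0 < u a" "z = (\<Sum>a\<in>T. u a *\<^sub>R edge_vec a)"
proof -
  obtain u where "\<forall>x\<in>edge_vec ` T. 0 < u x" "(\<Sum>x\<in>edge_vec ` T. u x *\<^sub>R x) = z"
    using z by (auto simp: rel_interior_convex_hull_explicit[OF tree_basis_affine_independent[OF T]])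
  then show ?thesis
    using that[of "u \<circ> edge_vec"] inj_on_subset[OF inj_edge_vec, of T] by (simp add: sum.reindex)
qed

text \<open>A smallest set of edge vectors with \<open>p\<close> in its hull is affinely independent
  by Caratheodory, hence linearly independent, and extends to a basis.\<close>

lemma tree_basis_through:
  assumes p: "p \<in> convex hull (edge_vec ` G)"
  obtains T where "tree_basis T" "p \<in> convex hull (edge_vec ` T)"
proof -
  let ?P = "\<lambda>S. S \<subseteq> edge_vec ` G \<and> p \<in> convex hull S"
  obtain S where S: "?P S" and min: "\<And>S'. ?P S' \<Longrightarrow> card S \<le> card S'"
    using ex_has_least_nat[of ?P "edge_vec ` G" card] p by auto
  obtain S' where "S' \<subseteq> S" "card S' \<le> aff_dim S + 1" "p \<in> convex hull S'"
    using S caratheodory_aff_dim[of S] by auto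
  then have "card S \<le> aff_dim S + 1" using min[of S'] S by fastforce
  moreover have fin: "finite S" using S by (meson finite finite_imageI finite_subset)
  moreover have "aff_dim S \<le> int (card S) - 1" using aff_dim_le_card[OF fin] .
  ultimately have "independent S"
    using edge_vecs_affine_dependent_iff S affine_independent_iff_card[of S] by simp
  then obtain B where B: "S \<subseteq> B" "B \<subseteq> edge_vec ` G" "independent B" "edge_vec ` G \<subseteq> span B"
    using maximal_independent_subset_extend S by metis
  then obtain T where "T \<subseteq> G" "B = edge_vec ` T" by (meson subset_imageE)
  then show ?thesis
    using that[of T] B S hull_mono[OF B(1), of convex] by (auto simp: tree_basis_def)
qed

text \<open>The flow of a side of \<open>b\<close> vanishes on the rest of \<open>T\<close> but
  equals \<open>c b\<close> up to sign on the new edge, so the new vector is independent of the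
  rest. Steinitz exchange then recovers \<open>b\<close> in the span.\<close>

lemma tree_basis_exchange:
  assumes T: "tree_basis T" and a: "a \<in> G" "a \<notin> T" and c: "c b \<noteq> 0"
    and expand: "edge_vec a = (\<Sum>b\<in>T. c b *\<^sub>R edge_vec b)" and b: "b \<in> T"
  shows "tree_basis (insert a (T - {b}))"
proof -
  let ?S = "edge_vec ` T"
  have TG: "T \<subseteq> G" using T by (simp add: tree_basis_def)
  obtain x y where xy: "b = {x, y}"
    by (rule edgeE[OF subsetD[OF TG b]]) (rule that)
  obtain B where B: "x \<notin> B" "y \<in> B" "separates T {x, y} B"
    using tree_basis_bridge[OF T] b xy by blast
  have diff: "edge_vec ` (T - {b}) = ?S - {edge_vec b}"
    by (simp add: image_set_diff[OF inj_edge_vec])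
  have "flow B z = 0" if z: "z \<in> edge_vec ` (T - {b})" for z
  proof -
    obtain d where d: "z = edge_vec d" "d \<in> T" "d \<noteq> b" using z by blast
    obtain u w where "d = {u, w}" by (rule edgeE[OF subsetD[OF TG d(2)]]) (rule that)
    with d have uw: "z = edge_vec {u, w}" "{u, w} \<in> T" "{u, w} \<noteq> b" by simp_all
    then have "u \<in> B \<longleftrightarrow> w \<in> B" using B(3) xy unfolding separates_def by blast
    then show ?thesis using uw flow_edge[of u w B] TG by auto
  qed
  then have "flow B z = 0" if "z \<in> span (edge_vec ` (T - {b}))" for z
    using linear_eq_0_on_span[OF linear_flow] that by blast
  moreover have "flow B (edge_vec a) \<noteq> 0"
    using flow_tree_edge[OF TG b[unfolded xy] B, of c] expand c xy by simp
  ultimately have notin: "edge_vec a \<notin> span (?S - {edge_vec b})"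
    using diff by metis
  have "independent (?S - {edge_vec b})"
    using T independent_mono[of ?S "?S - {edge_vec b}"] by (auto simp: tree_basis_def)
  with notin have "independent (insert (edge_vec a) (?S - {edge_vec b}))"
    by (rule independent_insertI)
  moreover have "edge_vec a \<in> span ?S" using T a by (auto simp: tree_basis_def)
  then have b_span: "edge_vec b \<in> span (insert (edge_vec a) (?S - {edge_vec b}))"
    using notin by (rule in_span_delete)
  have "?S \<subseteq> span (insert (edge_vec a) (?S - {edge_vec b}))"
  proof
    fix z assume "z \<in> ?S"
    then show "z \<in> span (insert (edge_vec a) (?S - {edge_vec b}))"
      using b_span by (cases "z = edge_vec b") (simp_all add: span_base)
  qed
  then have "edge_vec ` G \<subseteq> span (insert (edge_vec a) (?S - {edge_vec b}))"
    using T span_minimal[OF _ subspace_span] unfolding tree_basis_def by blast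
  ultimately show ?thesis
    using TG a diff by (auto simp: tree_basis_def)
qed

text \<open>The pivot step of the simplex method: move along the fundamental cycle of the new edge
  until a coefficient vanishes.\<close>

lemma tree_basis_pivot:
  assumes T: "tree_basis T" and p: "p \<in> convex hull (edge_vec ` T)"
    and a: "{e, v} \<in> G" "{e, v} \<notin> T" "e \<in> E" "v \<notin> E"
  obtains x y where "x \<in> E" "y \<notin> E" "{x, y} \<in> T"
    "tree_basis (insert {e, v} (T - {{x, y}}))"
    "p \<in> convex hull (edge_vec ` insert {e, v} (T - {{x, y}}))"
    "\<And>B. x \<notin> B \<Longrightarrow> y \<in> B \<Longrightarrow> separates T {x, y} B \<Longrightarrow> e \<notin> B \<and> v \<in> B"
proof -
  let ?a = "{e, v}"
  have TG: "T \<subseteq> G" using T by (simp add: tree_basis_def)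
  obtain c where c: "edge_vec ?a = (\<Sum>b\<in>T. c b *\<^sub>R edge_vec b)" "sum c T = 1"
    using tree_basis_expand[OF T a(1)] by blast
  obtain u where u: "\<forall>b\<in>T. 0 \<le> u b" "sum u T = 1" "p = (\<Sum>b\<in>T. u b *\<^sub>R edge_vec b)"
    using p unfolding convex_hull_edge_vec by blast
  let ?D = "{b \<in> T. 0 < c b}"
  \<comment> \<open>The coefficients \<open>c\<close> sum to 1, so one of them is positive.\<close>
  have "?D \<noteq> {}"
  proof
    assume "?D = {}"
    then have "sum c T \<le> 0" by (intro sum_nonpos) force
    then show False using c(2) by simp
  qed
  then obtain b where b: "b \<in> ?D" and min: "\<And>d. d \<in> ?D \<Longrightarrow> u b / c b \<le> u d / c d"
    using ex_is_arg_min_if_finite[of ?D "\<lambda>d. u d / c d"] by (auto simp: is_arg_min_linorder)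
  \<comment> \<open>Ratio test: \<open>t\<close> is the largest weight of the new edge for which all
    \<open>u d - t * c d\<close> stay nonnegative; the weight of \<open>b\<close> drops to
    0.\<close>
  define t where "t = u b / c b"
  have t: "0 \<le> t" using u(1) b by (simp add: t_def)
  obtain x y where xy: "x \<in> E" "y \<notin> E" "b = {x, y}" 
    by (rule edgeE[of b]) (use b TG that in auto)
  define w where "w = (\<lambda>d. if d = ?a then t else u d - t * c d)"
  let ?T = "insert ?a (T - {b})"
  have wb: "u b - t * c b = 0" using b by (simp add: t_def)
  have "p \<in> convex hull (edge_vec ` ?T)"
    unfolding convex_hull_edge_vec
  proof (intro CollectI exI conjI ballI)
    fix d assume d: "d \<in> ?T"
    show "0 \<le> w d"
    proof (cases "d = ?a \<or> c d \<le> 0")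
      case True
      then show ?thesis
        using d t u(1) mult_nonneg_nonpos[OF t, of "c d"] by (force simp: w_def)
    next
      case False
      then have "t * c d \<le> u d" using min[of d] d by (simp add: t_def pos_le_divide_eq)
      then show ?thesis using False by (simp add: w_def)
    qed
  next
    have aT: "?a \<notin> T - {b}" using a by simp
    have "sum w ?T = t + (\<Sum>d\<in>T - {b}. u d - t * c d)"
      using aT a by (simp add: w_def) (intro sum.cong; auto)
    also have "(\<Sum>d\<in>T - {b}. u d - t * c d) = (\<Sum>d\<in>T. u d - t * c d)"
      using b wb sum.remove[of T b "\<lambda>d. u d - t * c d"] by simp
    finally show "sum w ?T = 1"
      using u(2) c(2) by (simp add: sum_subtractf flip: sum_distrib_left)
    have "(\<Sum>d\<in>?T. w d *\<^sub>R edge_vec d) = t *\<^sub>R edge_vec ?a + (\<Sum>d\<in>T - {b}. (u d - t * c d) *\<^sub>R edge_vec d)"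
      using aT a by (simp add: w_def) (intro sum.cong; auto)
    also have "(\<Sum>d\<in>T - {b}. (u d - t * c d) *\<^sub>R edge_vec d) = (\<Sum>d\<in>T. (u d - t * c d) *\<^sub>R edge_vec d)"
      using b wb sum.remove[of T b "\<lambda>d. (u d - t * c d) *\<^sub>R edge_vec d"] by simp
    also have "\<dots> = p - t *\<^sub>R edge_vec ?a"
      using u(3) c(1)
      by (simp add: scaleR_diff_left sum_subtractf scaleR_sum_right)
    finally show "p = (\<Sum>d\<in>?T. w d *\<^sub>R edge_vec d)" by simp
  qed
  moreover have "tree_basis ?T"
    using tree_basis_exchange[OF T a(1,2) _ c(1)] b by simp
  \<comment> \<open>Since \<open>y\<close> is violet and \<open>c b > 0\<close>, the flow of the new
    edge is negative; so it crosses the boundary of \<open>B\<close> in the same direction as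
    \<open>{x, y}\<close>, violet end inside.\<close>
  moreover have "e \<notin> B \<and> v \<in> B" if "x \<notin> B" "y \<in> B" "separates T {x, y} B" for B
  proof -
    have "flow B (edge_vec ?a) = c {x, y} * sg y"
      using flow_tree_edge[OF TG _ that, of c] c(1) b xy by simp
    then have "of_bool (e \<in> B) - of_bool (v \<in> B) < (0::real)"
      using flow_edge[OF a(1), of B] a b xy by (simp add: sg_def)
    then show ?thesis by (auto split: if_splits)
  qed
  ultimately show ?thesis using that[of x y] xy b by blast
qed

end

section \<open>Jaeger trees\<close>

fun binary_code :: "(nat \<Rightarrow> nat) \<Rightarrow> nat \<Rightarrow> nat" where
  "binary_code g 0 = 0"
| "binary_code g (Suc n) = 2 * binary_code g n + g n"

lemma binary_code_cong: "(\<And>i. i < n \<Longrightarrow> g i = h i) \<Longrightarrow> binary_code g n = binary_code h n"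
  by (induction n) auto

text \<open>The earliest digit is the most significant. A strict gap doubles to at least 2, which a
  further digit of at most 1 cannot close.\<close>

lemma binary_code_less:
  assumes "\<And>i. i < k \<Longrightarrow> g i = h i" "g k < h k" "k < n" "\<And>i. g i \<le> 1"
  shows "binary_code g n < binary_code h n"
  using assms(3)
proof (induction n)
  case (Suc n)
  show ?case
  proof (cases "k = n")
    case True
    then show ?thesis using binary_code_cong[of k g h] assms(1,2) by simp
  next
    case False
    then have "binary_code g n < binary_code h n" using Suc by simp
    then show ?thesis using assms(4)[of n] by simp
  qed
qed simp

locale bipartite_ribbon = bipartite +
  fixes \<rho> :: "'a \<Rightarrow> 'a set \<Rightarrow> 'a set" and s :: "'a \<times> 'a set"
  assumes cyclic: "cyclic_on (\<rho> x) {a \<in> G. x \<in> a}"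
    and base: "s \<in> darts G"
begin

abbreviation pos :: "'a set set \<Rightarrow> nat \<Rightarrow> 'a \<times> 'a set" where
  "pos T n \<equiv> (tour_step \<rho> T ^^ n) s"

section \<open>Comparison of the tours of two trees\<close>

definition agree_upto :: "nat \<Rightarrow> 'a set set \<Rightarrow> 'a set set \<Rightarrow> bool" where
  "agree_upto n T T' \<longleftrightarrow> (\<forall>i<n. snd (pos T i) \<in> T \<longleftrightarrow> snd (pos T i) \<in> T')"

definition jaeger :: "'a set set \<Rightarrow> bool" where
  "jaeger T \<longleftrightarrow> tree_basis T \<and> (\<forall>e\<in>E. \<forall>v. v \<notin> E \<longrightarrow> {e, v} \<in> G - T \<longrightarrow> cut_at \<rho> T s {e, v} v)"

lemma V_cut_Jaeger_tree_iff:
  assumes "E \<inter> V = {}" "E \<union> V = UNIV"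
  shows "V_cut_Jaeger_tree E V G \<rho> s T \<longleftrightarrow> jaeger T"
proof -
  have V: "V = - E" using assms by auto
  have "(\<forall>a\<in>G - T. \<exists>v\<in>a \<inter> V. cut_at \<rho> T s a v) \<longleftrightarrow>
    (\<forall>e\<in>E. \<forall>v. v \<notin> E \<longrightarrow> {e, v} \<in> G - T \<longrightarrow> cut_at \<rho> T s {e, v} v)" (is "?l \<longleftrightarrow> ?r")
  proof
    assume l: ?l
    show ?r
    proof (intro ballI allI impI)
      fix e v assume ev: "e \<in> E" "v \<notin> E" "{e, v} \<in> G - T"
      obtain w where "w \<in> {e, v} \<inter> V" "cut_at \<rho> T s {e, v} w"
        using bspec[OF l ev(3)] by (rule bexE) (rule that)
      moreover have "{e, v} \<inter> V = {v}" using V ev by auto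
      ultimately show "cut_at \<rho> T s {e, v} v" by simp
    qed
  next
    assume r: ?r
    show ?l
    proof
      fix a assume a: "a \<in> G - T"
      obtain e v where "e \<in> E" "v \<notin> E" "e \<noteq> v" "a = {e, v}" "{e, v} \<in> G"
        by (rule edgeE[OF DiffD1[OF a]])
      then show "\<exists>v\<in>a \<inter> V. cut_at \<rho> T s a v" using r a V by (intro bexI[of _ v]) auto
    qed
  qed
  then show ?thesis
    by (simp add: V_cut_Jaeger_tree_def jaeger_def assms(2) spanning_tree_iff)
qed

lemma tree_basis_ribbon_tree: "tree_basis T \<Longrightarrow> ribbon_tree G T \<rho> s"
proof unfold_locales
  fix a assume "a \<in> G"
  then obtain e v where "e \<noteq> v" "a = {e, v}" by (rule edgeE) (rule that)
  then show "\<exists>x y. x \<noteq> y \<and> a = {x, y}" by blast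
qed (use tree_basis_bridge tree_basis_connected cyclic base in \<open>auto simp: tree_basis_def\<close>)

text \<open>A step depends on the tree only through membership of the current edge. Hence
  \<open>n\<close> equal decisions fix the positions up to and including \<open>n\<close>.\<close>

lemma agree_pos: "agree_upto n T T' \<Longrightarrow> i \<le> n \<Longrightarrow> pos T i = pos T' i"
proof (induction i)
  case (Suc i)
  then have "pos T i = pos T' i" by simp
  moreover have "snd (pos T i) \<in> T \<longleftrightarrow> snd (pos T i) \<in> T'"
    using Suc.prems unfolding agree_upto_def by (meson Suc_le_lessD)
  ultimately show ?case by (cases "pos T i") (auto simp: tour_step_def)
qed simp

lemma agree_sym: "agree_upto n T T' \<Longrightarrow> agree_upto n T' T"
  using agree_pos[of n T T'] unfolding agree_upto_def by (metis less_imp_le)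

text \<open>An edge in just one of the trees occurs somewhere in the tour of \<open>T\<close>;
  \<open>n\<close> is the least position with differing decisions.\<close>

lemma first_difference:
  assumes T: "tree_basis T" and T': "tree_basis T'" and "T \<noteq> T'"
  obtains n where "n < card (darts G)" "agree_upto n T T'"
    "snd (pos T n) \<in> T \<longleftrightarrow> snd (pos T n) \<notin> T'"
proof -
  interpret T: ribbon_tree G T \<rho> s by (rule tree_basis_ribbon_tree[OF T])
  let ?P = "\<lambda>n. snd (pos T n) \<in> T \<longleftrightarrow> snd (pos T n) \<notin> T'"
  obtain a where a: "a \<in> G" "a \<in> T \<longleftrightarrow> a \<notin> T'"
    using assms by (auto simp: tree_basis_def)
  obtain e v where "e \<in> E" "v \<notin> E" "e \<noteq> v" "a = {e, v}" "{e, v} \<in> G" by (rule edgeE[OF a(1)])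
  then obtain i where i: "i < T.period" "pos T i = (e, a)"
    using T.tour_index[of "(e, a)"] by (auto simp: darts_def)
  then have "?P i" using a by simp
  define n where "n = (LEAST n. ?P n)"
  have "?P n" "n \<le> i" unfolding n_def using \<open>?P i\<close> by (rule LeastI, rule Least_le)
  moreover have "agree_upto n T T'"
    unfolding agree_upto_def n_def using not_less_Least[of _ ?P] by blast
  ultimately show ?thesis using that[of n] i(1) T.period_eq_card by linarith
qed

text \<open>At the first difference of the tours, the flow out of the side of the tree edge that is
  visited later is positive on one simplex and nonpositive on the other.\<close>

lemma jaeger_rel_interiors_disjoint_aux:
  assumes J: "jaeger T" and J': "jaeger T'"
    and n: "n < card (darts G)" "agree_upto n T T'" "snd (pos T n) \<in> T" "snd (pos T n) \<notin> T'"
    and p: "p \<in> rel_interior (convex hull (edge_vec ` T))"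
    and p': "p \<in> rel_interior (convex hull (edge_vec ` T'))"
  shows False
proof -
  have tb: "tree_basis T" and tb': "tree_basis T'" using J J' by (auto simp: jaeger_def)
  have TG: "T \<subseteq> G" and TG': "T' \<subseteq> G" using tb tb' by (auto simp: tree_basis_def)
  interpret T: ribbon_tree G T \<rho> s by (rule tree_basis_ribbon_tree[OF tb])
  interpret T': ribbon_tree G T' \<rho> s by (rule tree_basis_ribbon_tree[OF tb'])
  note period = T.period_eq_card T'.period_eq_card
  have same: "a \<in> T \<longleftrightarrow> a \<in> T'" if "i < n" "pos T i = (x, a)" for i x a
    using n(2) that unfolding agree_upto_def by (metis snd_conv)
  obtain x c where xc: "pos T n = (x, c)" by fastforce
  then have c: "c \<in> T" "c \<notin> T'" using n by auto
  obtain e v where ev: "e \<in> E" "v \<notin> E" "e \<noteq> v" "c = {e, v}" "{e, v} \<in> G"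
    by (rule edgeE[OF subsetD[OF TG c(1)]])
  have "x \<in> c" using T.funpow_darts[OF base, of n] xc by (simp add: darts_def)
  \<comment> \<open>Otherwise \<open>c\<close>, being cut at \<open>v\<close> by \<open>T'\<close>,
    would occur as \<open>(v, c)\<close> before \<open>n\<close>, where the trees agree on every
    edge met.\<close>
  moreover have "x \<noteq> e"
  proof
    assume "x = e"
    obtain i j where ij: "i < j" "j < T'.period" "pos T' i = (v, c)" "pos T' j = (e, c)"
    proof -
      have "cut_at \<rho> T' s {e, v} v" using J' ev c unfolding jaeger_def by blast
      then show ?thesis using that ev(4) by (auto simp: T'.cut_at_iff)
    qed
    have "pos T' n = (e, c)" using agree_pos[OF n(2), of n] xc \<open>x = e\<close> by simp
    then have "j = n" using T'.tour_unique[of j n] ij n(1) period by simp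
    then have "pos T i = (v, c)" using agree_pos[OF n(2), of i] ij by simp
    then show False using same[of i v c] ij \<open>j = n\<close> c by simp
  qed
  ultimately have xv: "x = v" using ev by auto
  obtain m where m: "m < T.period" "pos T m = (e, c)"
    using T.tour_index[of "(e, c)"] ev by (auto simp: darts_def)
  have "\<not> m < n" using same m c by blast
  moreover have "m \<noteq> n" using m xc xv ev by auto
  ultimately have nm: "n < m" by simp
  have cve: "c = {v, e}" using ev by auto
  obtain B where B: "v \<notin> B" "e \<in> B" "separates T {v, e} B"
    using tree_basis_bridge[OF tb] c cve by blast
  \<comment> \<open>Positive flow means violet end outside and emerald end inside \<open>B\<close>.
    Such an edge is not in \<open>T\<close>, hence is cut at its violet end. If that happened after
    \<open>n\<close>, \<open>tour_crossing\<close> would put the emerald end first; before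
    \<open>n\<close>, the trees agree on the edge.\<close>
  have nonpos: "flow B (edge_vec a) \<le> 0" if a: "a \<in> T'" for a
  proof (rule ccontr)
    assume pos: "\<not> flow B (edge_vec a) \<le> 0"
    obtain e' v' where ev': "e' \<in> E" "v' \<notin> E" "e' \<noteq> v'" "a = {e', v'}" "{e', v'} \<in> G"
      by (rule edgeE[OF subsetD[OF TG' a]])
    then have sides: "e' \<in> B" "v' \<notin> B"
      using pos flow_edge[OF ev'(5), of B] by (auto simp: sg_def split: if_splits)
    have aT: "a \<notin> T"
    proof
      assume "a \<in> T"
      then have "a = c" using B(3) sides ev' cve unfolding separates_def by blast
      then show False using a c by simp
    qed
    obtain i j where ij: "i < j" "j < T.period" "pos T i = (v', a)" "pos T j = (e', a)"
    proof -
      have "cut_at \<rho> T s {e', v'} v'" using J ev' aT unfolding jaeger_def by blast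
      then show ?thesis using that ev'(4) by (auto simp: T.cut_at_iff)
    qed
    have "\<not> n < i"
    proof
      assume "n < i"
      have "j < i"
        by (rule T.tour_crossing[of v e n m B v' e'])
          (use c cve nm m xc xv B ev' sides ij \<open>n < i\<close> in \<open>auto simp: insert_commute\<close>)
      then show False using ij by simp
    qed
    moreover have "i \<noteq> n" using ij xc c aT by auto
    ultimately show False using same[of i v' a] ij aT a by simp
  qed
  obtain u where u: "\<And>a. a \<in> T \<Longrightarrow> 0 < u a" "p = (\<Sum>a\<in>T. u a *\<^sub>R edge_vec a)"
    using rel_interior_tree_simplex[OF tb p] by blast
  obtain u' where u': "\<And>a. a \<in> T' \<Longrightarrow> 0 < u' a" "p = (\<Sum>a\<in>T'. u' a *\<^sub>R edge_vec a)"
    using rel_interior_tree_simplex[OF tb' p'] by blast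
  have "flow B p = u c"
    using flow_tree_edge[OF TG c(1)[unfolded cve] B, of u] u(2) ev(1) cve by (simp add: sg_def)
  moreover have "flow B p \<le> 0"
    unfolding u'(2) flow_sum using u'(1) nonpos
    by (intro sum_nonpos mult_nonneg_nonpos) (auto intro: less_imp_le)
  ultimately show False using u(1)[OF c(1)] by simp
qed

text \<open>Either tree may be the one that contains the distinguishing edge, so the auxiliary lemma
  is applied in both orders.\<close>

lemma jaeger_rel_interiors_disjoint:
  assumes "jaeger T" "jaeger T'" "T \<noteq> T'"
  shows "rel_interior (convex hull (edge_vec ` T)) \<inter> rel_interior (convex hull (edge_vec ` T')) = {}"
proof -
  have tb: "tree_basis T" "tree_basis T'" using assms by (auto simp: jaeger_def)
  obtain n where n: "n < card (darts G)" "agree_upto n T T'"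
    "snd (pos T n) \<in> T \<longleftrightarrow> snd (pos T n) \<notin> T'"
    by (rule first_difference[OF tb assms(3)])
  have "pos T n = pos T' n" using agree_pos[OF n(2)] by simp
  then show ?thesis
    using n jaeger_rel_interiors_disjoint_aux[OF assms(1,2) n(1,2)]
      jaeger_rel_interiors_disjoint_aux[OF assms(2,1) n(1) agree_sym[OF n(2)]]
    by (cases "snd (pos T n) \<in> T") auto
qed

section \<open>Covering by a lexicographically best tree\<close>

definition score :: "'a set set \<Rightarrow> nat \<Rightarrow> nat" where
  "score T i = of_bool (fst (pos T i) \<in> E \<longleftrightarrow> snd (pos T i) \<in> T)"

text \<open>The tours coincide up to position \<open>k\<close>, where only \<open>T'\<close> takes
  the preferred decision: in the tree at an emerald node, outside it at a violet one.\<close>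

lemma score_improves:
  assumes agree: "agree_upto k T T'" and k: "k < card (darts G)" "pos T k = (x, c)"
    and better: "x \<in> E \<longleftrightarrow> c \<in> T'" "c \<in> T \<longleftrightarrow> c \<notin> T'"
  shows "binary_code (score T) (card (darts G)) < binary_code (score T') (card (darts G))"
proof (rule binary_code_less[OF _ _ k(1)])
  fix i
  show "score T i \<le> 1" by (simp add: score_def)
  show "score T i = score T' i" if "i < k"
  proof -
    have "snd (pos T i) \<in> T \<longleftrightarrow> snd (pos T i) \<in> T'"
      using agree that unfolding agree_upto_def by blast
    then show ?thesis using agree_pos[OF agree, of i] that by (simp add: score_def)
  qed
next
  show "score T k < score T' k"
  proof -
    have "pos T' k = (x, c)" using agree_pos[OF agree, of k] k(2) by simp
    then show ?thesis using k(2) better by (simp add: score_def)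
  qed
qed

lemma jaeger_cover:
  assumes p: "p \<in> convex hull (edge_vec ` G)"
  obtains T where "jaeger T" "p \<in> convex hull (edge_vec ` T)"
proof -
  let ?N = "card (darts G)"
  let ?P = "\<lambda>T. tree_basis T \<and> p \<in> convex hull (edge_vec ` T)"
  let ?W = "\<lambda>T. binary_code (score T) ?N"
  obtain T0 where "?P T0" using tree_basis_through[OF p] by blast
  \<comment> \<open>There are finitely many edge sets, so the codes are bounded and a best tree
    exists.\<close>
  moreover have "\<forall>T. ?P T \<longrightarrow> ?W T < Suc (Max (range ?W))"
    by (simp add: less_Suc_eq_le)
  ultimately obtain T where "?P T" and best: "\<And>T'. ?P T' \<Longrightarrow> ?W T' \<le> ?W T"
    using ex_has_greatest_nat[of ?P T0 ?W "Suc (Max (range ?W))"] by blast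
  then have tb: "tree_basis T" and pT: "p \<in> convex hull (edge_vec ` T)" by auto
  have TG: "T \<subseteq> G" using tb by (simp add: tree_basis_def)
  interpret T: ribbon_tree G T \<rho> s by (rule tree_basis_ribbon_tree[OF tb])
  have period: "T.period = ?N" by (rule T.period_eq_card)
  have "cut_at \<rho> T s {e, v} v" if ev: "e \<in> E" "v \<notin> E" and a: "{e, v} \<in> G" "{e, v} \<notin> T" for e v
  proof (rule ccontr)
    assume notcut: "\<not> cut_at \<rho> T s {e, v} v"
    let ?a = "{e, v}"
    obtain i where i: "i < T.period" "pos T i = (e, ?a)"
      using T.tour_index[of "(e, ?a)"] a by (auto simp: darts_def)
    obtain j where j: "j < T.period" "pos T j = (v, ?a)"
      using T.tour_index[of "(v, ?a)"] a by (auto simp: darts_def)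
    have "\<not> j < i" using notcut i j unfolding T.cut_at_iff by auto
    obtain x y where xy: "x \<in> E" "y \<notin> E" "{x, y} \<in> T"
      and tb': "tree_basis (insert ?a (T - {{x, y}}))"
      and pT': "p \<in> convex hull (edge_vec ` insert ?a (T - {{x, y}}))"
      and cut: "\<And>B. x \<notin> B \<Longrightarrow> y \<in> B \<Longrightarrow> separates T {x, y} B \<Longrightarrow> e \<notin> B \<and> v \<in> B"
      by (rule tree_basis_pivot[OF tb pT a ev]) (rule that)
    let ?c = "{x, y}"
    let ?T = "insert ?a (T - {?c})"
    obtain n where n: "n < T.period" "pos T n = (x, ?c)"
      using T.tour_index[of "(x, ?c)"] xy TG by (auto simp: darts_def)
    obtain m where m: "m < T.period" "pos T m = (y, ?c)"
      using T.tour_index[of "(y, ?c)"] xy TG by (auto simp: darts_def)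
    have ac: "?a \<noteq> ?c" using a xy by auto
    have "n \<noteq> m" "n \<noteq> i" "m \<noteq> i" using n m i ac xy by auto
    \<comment> \<open>If \<open>(x, ?c)\<close> came first, the crossing direction given by the
      pivot would force the tour to meet \<open>(v, ?a)\<close> before
      \<open>(e, ?a)\<close>.\<close>
    have "\<not> (n < m \<and> n < i)"
    proof
      assume nmi: "n < m \<and> n < i"
      obtain B where B: "x \<notin> B" "y \<in> B" "separates T {x, y} B"
        using tree_basis_bridge[OF tb xy(3)] by blast
      have "j < i"
        by (rule T.tour_crossing[of x y n m B e v]) (use nmi xy n m B cut[OF B] a i j in auto)
      then show False using \<open>\<not> j < i\<close> by simp
    qed
    then have order: "i < n \<and> i < m \<or> m < n \<and> m < i"
      using \<open>n \<noteq> m\<close> \<open>n \<noteq> i\<close> \<open>m \<noteq> i\<close> by linarith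
    \<comment> \<open>Before the first of \<open>(e, ?a)\<close>, \<open>(x, ?c)\<close> and
      \<open>(y, ?c)\<close>, neither exchanged edge has been met, as \<open>(v, ?a)\<close> does
      not precede \<open>(e, ?a)\<close>.\<close>
    have agree: "agree_upto k T ?T" if "k \<le> i" "k \<le> n" "k \<le> m" for k
      unfolding agree_upto_def
    proof (intro allI impI)
      fix l assume l: "l < k"
      obtain z d where zd: "pos T l = (z, d)" by fastforce
      have zin: "z \<in> d" using T.funpow_darts[OF base, of l] zd by (simp add: darts_def)
      have "d \<noteq> ?a"
      proof
        assume "d = ?a"
        then have "l = i \<or> l = j"
          using zin zd i j T.tour_unique[of l i] T.tour_unique[of l j] l that by auto
        then show False using l that \<open>\<not> j < i\<close> by auto
      qed
      moreover have "d \<noteq> ?c"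
      proof
        assume "d = ?c"
        then have "l = n \<or> l = m"
          using zin zd n m T.tour_unique[of l n] T.tour_unique[of l m] l that by auto
        then show False using l that by auto
      qed
      ultimately show "snd (pos T l) \<in> T \<longleftrightarrow> snd (pos T l) \<in> ?T" using zd by simp
    qed
    \<comment> \<open>The first change is either that \<open>?a\<close> enters the tree at an
      emerald node or that \<open>?c\<close> leaves it at a violet one; both raise the code.\<close>
    from order have "?W T < ?W ?T"
    proof
      assume "i < n \<and> i < m"
      then show ?thesis
        using score_improves[OF agree[of i], of e ?a] i period ev a by auto
    next
      assume "m < n \<and> m < i"
      then show ?thesis
        using score_improves[OF agree[of m], of y ?c] m period xy ac by auto
    qed
    then show False using best[of ?T] tb' pT' by simp
  qed
  then have "jaeger T" using tb by (auto simp: jaeger_def)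
  then show ?thesis using that pT by blast
qed

end

theorem theorem7p6:
  fixes E V :: "'n::finite set"
    and G :: "'n set set"
    and \<rho> :: "'n \<Rightarrow> 'n set \<Rightarrow> 'n set"
    and b0 b1 :: 'n
  assumes "E \<union> V = UNIV"
    and "bipartite_graph E V G"
    and "graph_connected (E \<union> V) G"
    and "ribbon_structure (E \<union> V) G \<rho>"
    and "{b0, b1} \<in> G"
  shows "dissection {T. V_cut_Jaeger_tree E V G \<rho> (b0, {b0, b1}) T}
           (\<lambda>T. root_polytope E V T) (root_polytope E V G)"
proof -
  have disj: "E \<inter> V = {}" using assms(2) by (simp add: bipartite_graph_def)
  \<comment> \<open>Disjointness and \<open>E \<union> V = UNIV\<close> make the violet nodes the
    complement of \<open>E\<close>, as the locale expects.\<close>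
  interpret bipartite_ribbon E G \<rho> "(b0, {b0, b1})"
  proof unfold_locales
    show "\<exists>e v. e \<in> E \<and> v \<notin> E \<and> a = {e, v}" if "a \<in> G" for a
      using that assms(2) unfolding bipartite_graph_def by blast
    show "(x, y) \<in> (adj G)\<^sup>*" for x y
      using assms(1,3) by (simp add: graph_connected_def)
    show "cyclic_on (\<rho> x) {a \<in> G. x \<in> a}" for x
      using assms(1,4) by (simp add: ribbon_structure_def)
    show "(b0, {b0, b1}) \<in> darts G"
      using assms(5) by (simp add: darts_def)
  qed
  have polytope: "root_polytope E V T = convex hull (edge_vec ` T)" if TG: "T \<subseteq> G" for T
  proof -
    have "{axis e 1 + axis v 1 :: real ^ 'n | e v. e \<in> E \<and> v \<in> V \<and> {e, v} \<in> T} = edge_vec ` T"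
    proof (intro set_eqI iffI)
      fix z assume "z \<in> {axis e 1 + axis v 1 :: real ^ 'n | e v. e \<in> E \<and> v \<in> V \<and> {e, v} \<in> T}"
      then obtain e v where "e \<in> E" "v \<in> V" "{e, v} \<in> T" "z = axis e 1 + axis v 1" by blast
      then show "z \<in> edge_vec ` T"
        using disj by (intro image_eqI[of _ _ "{e, v}"]) (auto intro!: edge_vec_doubleton[symmetric])
    next
      fix z assume "z \<in> edge_vec ` T"
      then obtain a where a: "a \<in> T" "z = edge_vec a" by blast
      obtain e v where "e \<in> E" "v \<notin> E" "e \<noteq> v" "a = {e, v}" "{e, v} \<in> G"
        by (rule edgeE[OF subsetD[OF TG a(1)]])
      moreover have "v \<in> V" using \<open>v \<notin> E\<close> assms(1) by blast
      ultimately show "z \<in> {axis e 1 + axis v 1 :: real ^ 'n | e v. e \<in> E \<and> v \<in> V \<and> {e, v} \<in> T}"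
        using a edge_vec_doubleton by blast
    qed
    then show ?thesis by (simp add: root_polytope_def)
  qed
  have J: "{T. V_cut_Jaeger_tree E V G \<rho> (b0, {b0, b1}) T} = {T. jaeger T}"
    using V_cut_Jaeger_tree_iff[OF disj assms(1)] by simp
  have QT: "root_polytope E V T = convex hull (edge_vec ` T)" "tree_basis T" "T \<subseteq> G" if "jaeger T" for T
    using that polytope by (auto simp: jaeger_def tree_basis_def)
  have QG: "root_polytope E V G = convex hull (edge_vec ` G)" by (rule polytope) simp
  show ?thesis
    unfolding dissection_def J QG
  proof (intro conjI)
    show "\<forall>T\<in>{T. jaeger T}. aff_dim (convex hull (edge_vec ` G)) simplex root_polytope E V T"
      using QT tree_basis_simplex by auto
    show "(\<Union>T\<in>{T. jaeger T}. root_polytope E V T) = convex hull (edge_vec ` G)"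
    proof (intro equalityI subsetI)
      fix p assume "p \<in> (\<Union>T\<in>{T. jaeger T}. root_polytope E V T)"
      then obtain T where T: "jaeger T" "p \<in> convex hull (edge_vec ` T)" using QT by auto
      show "p \<in> convex hull (edge_vec ` G)"
        by (rule subsetD[OF hull_mono[OF image_mono[OF QT(3)[OF T(1)]]] T(2)])
    next
      fix p assume "p \<in> convex hull (edge_vec ` G)"
      then obtain T where "jaeger T" "p \<in> convex hull (edge_vec ` T)" by (rule jaeger_cover)
      then show "p \<in> (\<Union>T\<in>{T. jaeger T}. root_polytope E V T)" using QT by auto
    qed
    show "disjoint_family_on (\<lambda>T. rel_interior (root_polytope E V T)) {T. jaeger T}"
      using jaeger_rel_interiors_disjoint QT(1) by (auto simp: disjoint_family_on_def)
  qed
qed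

end
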